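(* There exists a constant $\beta>0$ such that for all sufficiently large $X$, \[ \#\{1\leq n\leq X:\ \sigma moex(n)\text{ is odd}\}\geq \beta\log\log X . \]
   Context: For a partition $\pi$ of a positive integer $n$, $moex(\pi)$ is the smallest odd positive integer that is not a part of $\pi$. For a positive integer $n$, $\sigma moex(n)=\sum_{\pi} moex(\pi)$, summed over all partitions $\pi$ of $n$, and $\sigma moex(0)=1$. Equivalently, $\sum_{n\geq 0}\sigma moex(n)q^n=(-q;q)_\infty(-q;q^2)_\infty^2$, where $(a;q)_\infty=\prod_{m\geq 1}(1-aq^{m-1})$. *)

theory Defs
  imports Complex_Main "HOL-Library.Multiset"
begin

definition partitions_of :: "nat \<Rightarrow> nat multiset set" where
  "partitions_of n = {\<pi>. 0 \<notin># \<pi> \<and> sum_mset \<pi> = n}"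

definition moex :: "nat multiset \<Rightarrow> nat" where
  "moex \<pi> = (LEAST k. odd k \<and> k \<notin># \<pi>)"

definition sigma_moex :: "nat \<Rightarrow> nat" where
  "sigma_moex n = (\<Sum>\<pi>\<in>partitions_of n. moex \<pi>)"

lemma finite_partitions_of: "finite (partitions_of n)"
proof -
  have "partitions_of n \<subseteq> mset ` {xs. set xs \<subseteq> {..n} \<and> length xs \<le> n}"
  proof
    fix \<pi> assume "\<pi> \<in> partitions_of n"
    then have pos: "0 \<notin># \<pi>" and s: "sum_mset \<pi> = n" by (auto simp: partitions_of_def)
    obtain xs where xs: "mset xs = \<pi>" using ex_mset by blast
    have "set xs \<subseteq> {..n}"
      using s xs member_le_sum_list[of _ xs] by (auto simp flip: sum_mset_sum_list)
    moreover have "length ys \<le> sum_list ys" if "0 \<notin> set ys" for ys :: "nat list"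
      using that by (induction ys) auto
    then have "length xs \<le> n"
      using pos s xs by (auto simp flip: sum_mset_sum_list)
    ultimately show "\<pi> \<in> mset ` {xs. set xs \<subseteq> {..n} \<and> length xs \<le> n}"
      using xs by auto
  qed
  then show ?thesis
    by (rule finite_subset) (intro finite_imageI finite_lists_length_le, simp)
qed

lemma moex_correct: "odd (moex \<pi>) \<and> moex \<pi> \<notin># \<pi>"
proof -
  obtain k where "k > Max (insert 0 (set_mset \<pi>))" "odd k"
    by (metis even_Suc less_Suc_eq lessI)
  then have "odd k \<and> k \<notin># \<pi>"
    by (metis Max_ge finite_insert finite_set_mset insertCI leD)
  then show ?thesis unfolding moex_def by (rule LeastI)
qed

lemma sigma_moex_0: "sigma_moex 0 = 1"
proof -
  have "partitions_of 0 = {{#}}"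
    by (auto simp: partitions_of_def sum_mset_0_iff) (metis multiset_nonemptyE)
  moreover have "moex {#} = 1"
    unfolding moex_def by (rule Least_equality) (auto elim: oddE)
  ultimately show ?thesis by (simp add: sigma_moex_def)
qed

end

theory Submission
  imports Defs "HOL-Library.Nat_Bijection" "HOL-Computational_Algebra.Formal_Power_Series"
begin

text \<open>
  Since \<open>moex\<close> only takes odd values, \<open>sigma_moex n\<close> has the parity of the partition number
  \<open>p(n)\<close>. Euler's recurrence \<open>\<Sum>\<^sub>j (-1)\<^sup>j p(N - j(3j+1)/2) = 0\<close>, taken at a generalized pentagonal
  number \<open>N = k(3k+1)/2\<close>, contains the odd term \<open>p(0) = 1\<close>, and the largest generalized pentagonal
  number below \<open>N\<close> is \<open>N - k\<close>. Hence some \<open>p(i)\<close> with \<open>k \<le> i \<le> N\<close> is odd. As \<open>N < k\<^sup>3\<close> for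
  \<open>k \<ge> 2\<close>, the disjoint intervals from \<open>2^(3^i)\<close> to \<open>2^(3^(i+1))\<close> each contain such an index,
  which gives the doubly logarithmic bound. The recurrence follows from a finite identity of
  Shanks, which is proved by telescoping.
\<close>

unbundle fps_syntax

section \<open>Partitions into parts from a given set\<close>

definition partitions_into :: "nat set \<Rightarrow> nat \<Rightarrow> nat multiset set" where
  "partitions_into A n = {\<pi>. set_mset \<pi> \<subseteq> A \<and> sum_mset \<pi> = n}"

definition partition_number :: "nat \<Rightarrow> nat" where
  "partition_number n = card (partitions_of n)"

definition partition_fps :: "nat set \<Rightarrow> 'a::comm_ring_1 fps" where
  "partition_fps A = Abs_fps (\<lambda>n. of_nat (card (partitions_into A n)))"

lemma finite_partitions_into:
  assumes "0 \<notin> A"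
  shows "finite (partitions_into A n)"
proof (rule finite_subset[OF _ finite_partitions_of])
  show "partitions_into A n \<subseteq> partitions_of n"
    using assms by (auto simp: partitions_into_def partitions_of_def)
qed

lemma partitions_into_empty: "partitions_into {} n = (if n = 0 then {{#}} else {})"
  by (auto simp: partitions_into_def)

lemma partitions_into_atLeastAtMost:
  assumes "n \<le> k"
  shows "partitions_into {1..k} n = partitions_of n"
proof -
  have "x \<le> k" if "x \<in># \<pi>" "sum_mset \<pi> = n" for x \<pi>
    using that assms by (auto dest!: multi_member_split)
  then show ?thesis
    by (auto simp: partitions_into_def partitions_of_def Suc_le_eq intro: gr0I)
qed

lemma partition_number_0: "partition_number 0 = 1"
proof -
  have "partitions_of 0 = {{#}}"
    using partitions_into_atLeastAtMost[of 0 0] by (simp add: partitions_into_empty)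
  then show ?thesis
    by (simp add: partition_number_def)
qed

lemma partitions_into_insert:
  "partitions_into (insert a A) n = partitions_into A n \<union>
     (if a \<le> n then add_mset a ` partitions_into (insert a A) (n - a) else {})"
    (is "?L = ?A \<union> ?B")
proof
  show "?L \<subseteq> ?A \<union> ?B"
  proof
    fix \<pi> assume \<pi>: "\<pi> \<in> ?L"
    show "\<pi> \<in> ?A \<union> ?B"
    proof (cases "a \<in># \<pi>")
      case True
      then obtain \<rho> where "\<pi> = add_mset a \<rho>"
        by (rule mset_add)
      then show ?thesis
        using \<pi> by (auto simp: partitions_into_def)
    next
      case False
      then show ?thesis
        using \<pi> by (auto simp: partitions_into_def)
    qed
  qed
  show "?A \<union> ?B \<subseteq> ?L"
    by (auto simp: partitions_into_def split: if_splits)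
qed

lemma card_partitions_into_insert:
  assumes "a \<notin> A" and "0 \<notin> insert a A"
  shows "card (partitions_into (insert a A) n) = card (partitions_into A n) +
    (if a \<le> n then card (partitions_into (insert a A) (n - a)) else 0)"
proof (cases "a \<le> n")
  case True
  let ?B = "add_mset a ` partitions_into (insert a A) (n - a)"
  have "partitions_into A n \<inter> ?B = {}"
    using assms(1) by (fastforce simp: partitions_into_def)
  moreover have "card ?B = card (partitions_into (insert a A) (n - a))"
    by (rule card_image) (simp add: inj_on_def)
  moreover have "partitions_into (insert a A) n = partitions_into A n \<union> ?B"
    using True by (subst partitions_into_insert) simp
  ultimately show ?thesis
    using True assms(2) by (simp add: card_Un_disjoint finite_partitions_into)
next
  case False
  then have "partitions_into (insert a A) n = partitions_into A n"
    by (subst partitions_into_insert) simp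
  then show ?thesis
    using False by simp
qed

lemma partition_fps_empty: "partition_fps {} = 1"
  by (rule fps_ext) (simp add: partition_fps_def partitions_into_empty)

lemma partition_fps_insert:
  assumes "a \<notin> A" and "0 \<notin> insert a A"
  shows "partition_fps (insert a A) * (1 - fps_X ^ a) = partition_fps A"
proof (rule fps_ext)
  fix n
  show "(partition_fps (insert a A) * (1 - fps_X ^ a)) $ n = partition_fps A $ n"
    using card_partitions_into_insert[OF assms, of n]
    by (auto simp: partition_fps_def right_diff_distrib fps_X_power_mult_right_nth)
qed

lemma partition_fps_times_prod:
  assumes "finite A" and "0 \<notin> A"
  shows "partition_fps A * (\<Prod>k\<in>A. 1 - fps_X ^ k) = (1 :: 'a::comm_ring_1 fps)"
  using assms
proof (induction A rule: finite_induct)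
  case empty
  then show ?case
    by (simp add: partition_fps_empty)
next
  case (insert a A)
  then have "partition_fps (insert a A) * (\<Prod>k\<in>insert a A. 1 - fps_X ^ k :: 'a fps) =
      (partition_fps (insert a A) * (1 - fps_X ^ a)) * (\<Prod>k\<in>A. 1 - fps_X ^ k)"
    by (simp add: mult.assoc)
  also have "\<dots> = 1"
    using insert by (simp add: partition_fps_insert)
  finally show ?case .
qed

section \<open>Generalized pentagonal numbers\<close>

definition pentagonal :: "int \<Rightarrow> nat" where
  "pentagonal j = nat (j * (3 * j + 1) div 2)"

lemma two_times_pentagonal: "2 * int (pentagonal j) = j * (3 * j + 1)"
proof -
  have "0 \<le> j * (3 * j + 1)"
    by (cases "0 \<le> j") (auto simp: zero_le_mult_iff)
  moreover have "even (j * (3 * j + 1))"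
    by simp
  ultimately show ?thesis
    unfolding pentagonal_def by simp
qed

lemma two_times_triangle: "2 * int (triangle n) = int n * (int n + 1)"
  by (induction n) (auto simp: algebra_simps)

lemma pentagonal_of_nat: "pentagonal (int n) = n * n + triangle n"
proof -
  have "2 * int (pentagonal (int n)) = 2 * int (n * n + triangle n)"
    using two_times_triangle[of n] by (simp add: two_times_pentagonal algebra_simps)
  then show ?thesis
    by (simp only: mult_cancel_left of_nat_eq_iff) simp
qed

lemma pentagonal_uminus_Suc: "pentagonal (- int (Suc n)) = Suc n * Suc n + triangle n"
proof -
  have "2 * int (pentagonal (- int (Suc n))) = 2 * int (Suc n * Suc n + triangle n)"
    using two_times_triangle[of n] by (simp add: two_times_pentagonal algebra_simps)
  then show ?thesis
    by (simp only: mult_cancel_left of_nat_eq_iff) simp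
qed

lemma abs_le_pentagonal: "\<bar>j\<bar> \<le> int (pentagonal j)"
proof -
  have "\<bar>j\<bar> \<le> j * j"
    using mult_right_mono[of 1 "\<bar>j\<bar>" "\<bar>j\<bar>"] by (cases "j = 0") auto
  then show ?thesis
    using two_times_pentagonal[of j] by (simp add: algebra_simps)
qed

lemma pentagonal_leD: "pentagonal j \<le> n \<Longrightarrow> j \<in> {- int n..int n}"
  using abs_le_pentagonal[of j] by auto

lemma pentagonal_gap:
  assumes "0 \<le> k" and "j \<noteq> k" and "pentagonal j \<le> pentagonal k"
  shows "int (pentagonal j) + k \<le> int (pentagonal k)"
proof -
  have "(k - j) * (3 * (k + j) + 1) = 2 * int (pentagonal k) - 2 * int (pentagonal j)"
    unfolding two_times_pentagonal by (simp add: algebra_simps)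
  then have "0 \<le> (k - j) * (3 * (k + j) + 1)"
    using assms(3) by simp
  then have "- k \<le> j" "j < k"
    using assms(1,2) by (auto simp: zero_le_mult_iff)
  then have "0 \<le> (k + j) * (3 * (k - j) - 1)"
    by simp
  also have "\<dots> = 2 * int (pentagonal k) - 2 * int (pentagonal j) - 2 * k"
    unfolding two_times_pentagonal by (simp add: algebra_simps)
  finally show ?thesis
    by linarith
qed

lemma pentagonal_less_cube:
  assumes "2 \<le> k"
  shows "pentagonal (int k) < k ^ 3"
proof -
  have "2 * k \<le> k * k"
    using assms by simp
  then have "3 * k + 1 < 2 * (k * k)"
    using assms by linarith
  then have "k * (3 * k + 1) < k * (2 * (k * k))"
    using assms by (simp del: mult_Suc_right)
  then have "int (k * (3 * k + 1)) < int (k * (2 * (k * k)))"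
    by (simp only: of_nat_less_iff)
  then have "int (pentagonal (int k)) < int (k ^ 3)"
    using two_times_pentagonal[of "int k"] by (simp add: power3_eq_cube algebra_simps)
  then show ?thesis
    by (simp only: of_nat_less_iff)
qed

section \<open>Shanks' identity and the pentagonal number theorem\<close>

definition shanks_term :: "'a::comm_ring_1 \<Rightarrow> nat \<Rightarrow> nat \<Rightarrow> 'a" where
  "shanks_term q n s = (-1) ^ s * (\<Prod>k=Suc s..n. 1 - q ^ k) * q ^ (s * n + triangle s)"

definition pentagonal_sum :: "'a::comm_ring_1 \<Rightarrow> nat \<Rightarrow> 'a" where
  "pentagonal_sum q n = (\<Sum>j = - int n..int n. (-1) ^ nat \<bar>j\<bar> * q ^ pentagonal j)"

lemma shanks_term_Suc:
  assumes "s \<le> n"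
  shows "shanks_term q (Suc n) s = (1 - q ^ Suc n) * q ^ s * shanks_term q n s"
  using assms by (simp add: shanks_term_def power_add mult_ac del: power_Suc)

lemma shanks_term_shift:
  assumes "s < n"
  shows "shanks_term q n (Suc s) * (1 - q ^ Suc s) = - (q ^ (Suc n + s) * shanks_term q n s)"
proof -
  have "(\<Prod>k=Suc s..n. 1 - q ^ k) = (1 - q ^ Suc s) * (\<Prod>k=Suc (Suc s)..n. 1 - q ^ k)"
    using assms by (intro prod.atLeast_Suc_atMost) auto
  moreover have "Suc s * n + triangle (Suc s) = (Suc n + s) + (s * n + triangle s)"
    by simp
  ultimately show ?thesis
    unfolding shanks_term_def by (simp only: power_add power_Suc mult_ac) simp
qed

lemma sum_shanks_term_diff:
  assumes "m \<le> n"
  shows "(\<Sum>s\<le>m. shanks_term q (Suc n) s - shanks_term q n s) =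
    - (q ^ (Suc n + m) * shanks_term q n m)"
  using assms
proof (induction m)
  case 0
  then show ?case
    by (simp add: shanks_term_Suc algebra_simps)
next
  case (Suc m)
  have "(\<Sum>s\<le>Suc m. shanks_term q (Suc n) s - shanks_term q n s) =
      shanks_term q n (Suc m) * (1 - q ^ Suc m) +
      ((1 - q ^ Suc n) * q ^ Suc m * shanks_term q n (Suc m) - shanks_term q n (Suc m))"
    using Suc by (simp add: shanks_term_Suc shanks_term_shift del: power_Suc)
  also have "\<dots> = - (q ^ (Suc n + Suc m) * shanks_term q n (Suc m))"
    by (simp only: power_add) (simp add: algebra_simps)
  finally show ?case .
qed

lemma pentagonal_sum_Suc:
  "pentagonal_sum q (Suc n) = pentagonal_sum q n +
    (-1) ^ Suc n * (q ^ (Suc n * Suc n + triangle (Suc n)) + q ^ (Suc n * Suc n + triangle n))"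
proof -
  have "{- int (Suc n)..int (Suc n)} =
      insert (int (Suc n)) (insert (- int (Suc n)) {- int n..int n})"
    by auto
  then have "pentagonal_sum q (Suc n) = (-1) ^ Suc n * q ^ pentagonal (int (Suc n)) +
      ((-1) ^ Suc n * q ^ pentagonal (- int (Suc n)) + pentagonal_sum q n)"
    unfolding pentagonal_sum_def by (simp del: of_nat_Suc power_Suc)
  then show ?thesis
    unfolding pentagonal_of_nat pentagonal_uminus_Suc by (simp only: ring_distribs add_ac)
qed

lemma shanks_identity: "(\<Sum>s\<le>n. shanks_term q n s) = pentagonal_sum q n"
proof (induction n)
  case 0
  then show ?case
    by (simp add: shanks_term_def pentagonal_sum_def pentagonal_def)
next
  case (Suc n)
  have "(\<Sum>s\<le>Suc n. shanks_term q (Suc n) s) =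
      (\<Sum>s\<le>n. shanks_term q n s) + (\<Sum>s\<le>n. shanks_term q (Suc n) s - shanks_term q n s)
        + shanks_term q (Suc n) (Suc n)"
    by (simp add: sum_subtractf)
  also have "\<dots> = pentagonal_sum q n - q ^ (Suc n + n) * shanks_term q n n
      + shanks_term q (Suc n) (Suc n)"
    using Suc sum_shanks_term_diff[of n n q] by simp
  also have "q ^ (Suc n + n) * shanks_term q n n = (-1) ^ n * q ^ (Suc n * Suc n + triangle n)"
    by (simp add: shanks_term_def algebra_simps flip: power_add power_Suc)
  also have "shanks_term q (Suc n) (Suc n) = (-1) ^ Suc n * q ^ (Suc n * Suc n + triangle (Suc n))"
    by (simp add: shanks_term_def)
  finally show ?case
    unfolding pentagonal_sum_Suc by (simp add: ring_distribs del: triangle_Suc mult_Suc)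
qed

lemma truncated_pentagonal_number_theorem:
  "q ^ Suc n dvd pentagonal_sum q n - (\<Prod>k=1..n. 1 - q ^ k)"
proof -
  have "q ^ Suc n dvd shanks_term q n s" if "s \<in> {1..n}" for s
  proof -
    have "Suc n \<le> s * n + triangle s"
      using that by (cases s) auto
    then show ?thesis
      unfolding shanks_term_def by (intro dvd_mult le_imp_power_dvd)
  qed
  then have "q ^ Suc n dvd (\<Sum>s=1..n. shanks_term q n s)"
    by (rule dvd_sum)
  moreover have "pentagonal_sum q n = (\<Prod>k=1..n. 1 - q ^ k) + (\<Sum>s=1..n. shanks_term q n s)"
    unfolding shanks_identity[symmetric] atMost_atLeast0
    by (simp add: sum.atLeast_Suc_atMost shanks_term_def)
  ultimately show ?thesis
    by simp
qed

section \<open>Odd partition numbers\<close>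

lemma pentagonal_recurrence:
  assumes "n > 0"
  shows "(\<Sum>j | pentagonal j \<le> n.
    (-1) ^ nat \<bar>j\<bar> * int (partition_number (n - pentagonal j))) = 0"
proof -
  let ?P = "partition_fps {1..n} :: int fps"
  have nth_P: "?P $ i = int (partition_number i)" if "i \<le> n" for i
    using that
    by (simp add: partition_fps_def partition_number_def partitions_into_atLeastAtMost
        del: One_nat_def)
  obtain R where R: "pentagonal_sum fps_X n =
      (\<Prod>k=1..n. 1 - fps_X ^ k) + fps_X ^ Suc n * (R :: int fps)"
    using truncated_pentagonal_number_theorem[of fps_X n] by (auto simp: dvd_def algebra_simps)
  have "?P * pentagonal_sum fps_X n = 1 + fps_X ^ Suc n * (?P * R)"
    unfolding R distrib_left by (simp add: partition_fps_times_prod mult_ac del: power_Suc)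
  then have "(?P * pentagonal_sum fps_X n) $ n = 0"
    using assms by (simp add: fps_X_power_mult_nth del: power_Suc)
  moreover have "(?P * ((-1) ^ i * fps_X ^ m)) $ n =
      (if m \<le> n then (-1) ^ i * int (partition_number (n - m)) else 0)" for i m
    by (cases "even i") (auto simp: fps_X_power_mult_right_nth nth_P simp del: One_nat_def)
  ultimately have "(\<Sum>j = - int n..int n. if pentagonal j \<le> n
      then (-1) ^ nat \<bar>j\<bar> * int (partition_number (n - pentagonal j)) else 0) = 0"
    by (simp add: pentagonal_sum_def sum_distrib_left fps_sum_nth)
  moreover have "{j \<in> {- int n..int n}. pentagonal j \<le> n} = {j. pentagonal j \<le> n}"
    using pentagonal_leD by blast
  ultimately show ?thesis
    by (simp flip: sum.inter_filter)
qed

lemma ex_odd_partition_number: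
  assumes "1 \<le> k"
  obtains i where "k \<le> i" and "i \<le> pentagonal (int k)" and "odd (partition_number i)"
proof -
  let ?N = "pentagonal (int k)"
  let ?J = "{j. pentagonal j \<le> ?N}"
  define t where "t j = (-1) ^ nat \<bar>j\<bar> * int (partition_number (?N - pentagonal j))" for j
  have "finite ?J"
    by (rule finite_subset[of _ "{- int ?N..int ?N}"]) (use pentagonal_leD in blast, simp)
  have "0 < ?N"
    using abs_le_pentagonal[of "int k"] assms by linarith
  then have "0 = sum t ?J"
    unfolding t_def by (rule pentagonal_recurrence[symmetric])
  also have "\<dots> = t (int k) + sum t (?J - {int k})"
    using \<open>finite ?J\<close> by (rule sum.remove) simp
  finally have "sum t (?J - {int k}) = - t (int k)"
    by linarith
  moreover have "odd (t (int k))"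
    by (simp add: t_def partition_number_0)
  ultimately have "odd (sum t (?J - {int k}))"
    by simp
  then obtain j where j: "j \<in> ?J - {int k}" "odd (t j)"
    by (meson dvd_sum)
  then have "int (pentagonal j) + int k \<le> int ?N"
    by (intro pentagonal_gap) auto
  moreover have "odd (partition_number (?N - pentagonal j))"
    using j(2) by (simp add: t_def)
  ultimately show thesis
    by (intro that[of "?N - pentagonal j"]) auto
qed

lemma odd_sigma_moex_iff: "odd (sigma_moex n) \<longleftrightarrow> odd (partition_number n)"
proof -
  have "{\<pi> \<in> partitions_of n. odd (moex \<pi>)} = partitions_of n"
    using moex_correct by blast
  then show ?thesis
    by (simp add: sigma_moex_def partition_number_def even_sum_iff finite_partitions_of)
qed

lemma ex_odd_sigma_moex:
  assumes "2 \<le> k"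
  shows "\<exists>n\<ge>k. n < k ^ 3 \<and> odd (sigma_moex n)"
proof -
  obtain n where "k \<le> n" "n \<le> pentagonal (int k)" "odd (partition_number n)"
    using assms by (auto intro: ex_odd_partition_number[of k])
  then show ?thesis
    using pentagonal_less_cube[OF assms] odd_sigma_moex_iff by auto
qed

section \<open>Counting in sets that meet long intervals\<close>

lemma le_card_if_meets_consecutive_intervals:
  fixes a :: "nat \<Rightarrow> nat"
  assumes "\<And>i. \<exists>n\<in>S. a i \<le> n \<and> n < a (Suc i)"
  shows "M \<le> card (S \<inter> {..<a M})"
proof (induction M)
  case (Suc M)
  obtain n where n: "n \<in> S" "a M \<le> n" "n < a (Suc M)"
    using assms by blast
  have "Suc M \<le> card (insert n (S \<inter> {..<a M}))"
    using Suc n(2) by simp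
  also have "\<dots> \<le> card (S \<inter> {..<a (Suc M)})"
    using n by (intro card_mono) auto
  finally show ?case .
qed simp

lemma log_log_le_card_if_meets_intervals:
  fixes b d :: nat and X :: real
  assumes "1 < b" and "1 < d" and "b \<le> X"
    and meets: "\<And>k. b \<le> k \<Longrightarrow> \<exists>n\<in>S. k \<le> n \<and> n < k ^ d"
  shows "log d (log b X) - 1 \<le> card {n\<in>S. real n \<le> X}"
proof -
  define M where "M = nat \<lfloor>log d (log b X)\<rfloor>"
  have "1 \<le> log b X"
    using assms by (simp add: le_log_iff)
  then have "0 \<le> log d (log b X)"
    using assms(2) by simp
  then have floor_bounds: "real M \<le> log d (log b X)" "log d (log b X) - 1 \<le> real M"
    unfolding M_def by linarith+
  have "real d ^ M \<le> log b X"
    using floor_bounds(1) assms(2) \<open>1 \<le> log b X\<close> by (simp add: le_log_iff powr_realpow)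
  then have "real b powr real (d ^ M) \<le> X"
    using assms by (simp add: le_log_iff)
  then have "real (b ^ d ^ M) \<le> X"
    using assms(1) by (subst (asm) powr_realpow) simp_all
  have "\<exists>n\<in>S. b ^ d ^ i \<le> n \<and> n < b ^ d ^ Suc i" for i
    using meets[of "b ^ d ^ i"] assms(1,2)
    by (simp add: power_mult[symmetric] mult.commute self_le_power)
  then have "M \<le> card (S \<inter> {..<b ^ d ^ M})"
    by (rule le_card_if_meets_consecutive_intervals)
  also have "\<dots> \<le> card {n\<in>S. real n \<le> X}"
  proof (rule card_mono)
    show "finite {n\<in>S. real n \<le> X}"
      by (rule finite_subset[of _ "{..nat \<lfloor>X\<rfloor>}"]) (auto simp: le_nat_floor)
    show "S \<inter> {..<b ^ d ^ M} \<subseteq> {n\<in>S. real n \<le> X}"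
      using \<open>real (b ^ d ^ M) \<le> X\<close> by (auto intro: order_trans[rotated] simp flip: of_nat_power)
  qed
  finally show ?thesis
    using floor_bounds(2) by linarith
qed

lemma eventually_ln_ln_le_card_if_meets_intervals:
  fixes d :: nat
  assumes "1 < d"
    and "\<forall>\<^sub>F k in sequentially. \<exists>n\<in>S. k \<le> n \<and> n < k ^ d"
  shows "\<forall>\<^sub>F X::real in at_top. ln (ln X) / (2 * ln d) \<le> card {n\<in>S. real n \<le> X}"
proof -
  obtain c where "\<And>k. c \<le> k \<Longrightarrow> \<exists>n\<in>S. k \<le> n \<and> n < k ^ d"
    using assms(2) unfolding eventually_sequentially by blast
  then obtain b where b: "1 < b" "\<And>k. b \<le> k \<Longrightarrow> \<exists>n\<in>S. k \<le> n \<and> n < k ^ d"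
    using that[of "max c 2"] by simp
  have "filterlim (\<lambda>X::real. ln (ln X)) at_top at_top"
    by (rule filterlim_compose[OF ln_at_top ln_at_top])
  then have "\<forall>\<^sub>F X::real in at_top. 2 * (ln d + ln (ln b)) \<le> ln (ln X)"
    by (simp add: filterlim_at_top)
  then show ?thesis
    using eventually_ge_at_top[of "real b"]
  proof eventually_elim
    case (elim X)
    have "0 < ln (real b)" "0 < ln X" "0 < ln (real d)"
      using assms(1) b(1) elim(2) by auto
    then have "log d (log b X) - 1 = (ln (ln X) - ln (ln b) - ln d) / ln d"
      by (simp add: log_def ln_div diff_divide_distrib)
    moreover have "ln (ln X) / 2 / ln d \<le> (ln (ln X) - ln (ln b) - ln d) / ln d"
      using elim(1) \<open>0 < ln (real d)\<close> by (intro divide_right_mono) auto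
    ultimately show ?case
      using log_log_le_card_if_meets_intervals[OF b(1) assms(1) elim(2) b(2)] by simp
  qed
qed

theorem theorem1p5:
  "\<exists>\<beta>::real. \<beta> > 0 \<and>
     (\<forall>\<^sub>F X::real in at_top.
        real (card {n::nat. 1 \<le> n \<and> real n \<le> X \<and> odd (sigma_moex n)}) \<ge> \<beta> * ln (ln X))"
proof (intro exI conjI)
  let ?S = "{n. 1 \<le> n \<and> odd (sigma_moex n)}"
  show "0 < 1 / (2 * ln (real 3))"
    by simp
  have "\<forall>\<^sub>F k in sequentially. \<exists>n\<in>?S. k \<le> n \<and> n < k ^ 3"
    using eventually_ge_at_top[of 2] by eventually_elim (use ex_odd_sigma_moex in fastforce)
  then have "\<forall>\<^sub>F X::real in at_top. ln (ln X) / (2 * ln (real 3)) \<le> card {n\<in>?S. real n \<le> X}"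
    by (intro eventually_ln_ln_le_card_if_meets_intervals) auto
  moreover have "{n\<in>?S. real n \<le> X} = {n. 1 \<le> n \<and> real n \<le> X \<and> odd (sigma_moex n)}" for X
    by auto
  ultimately show "\<forall>\<^sub>F X::real in at_top.
      real (card {n. 1 \<le> n \<and> real n \<le> X \<and> odd (sigma_moex n)})
        \<ge> 1 / (2 * ln (real 3)) * ln (ln X)"
    by simp
qed

end
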